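(* Let $M$ be a matroid on a finite set $V$ and let $N$ be a matroid on $\mathrm{Sym}_2(V)$. Then the following statements are equivalent (all properties of $N$ being with respect to $M$, with $k=2$): (1) $N$ is a second symmetric power of $M$. (2) $N$ satisfies the SP-rank Property and Multilinearity. (3) $N$ satisfies the SP-rank Property and Circuit Multilinearity. (4) $N$ satisfies the SP-rank Property and Strong Order Multilinearity. (5) $N$ satisfies the Flat Property and Strong Order Multilinearity.
   Context: For a finite set $V$ and an integer $k\ge 0$, $\mathrm{Sym}_k(V)$ is the set of unordered $k$-words (multisets of size $k$) over $V$; $\mathrm{Sym}_0(V)=\{\emptyset\}$ (empty word) and $\mathrm{Sym}_1(V)=V$. For $\alpha\in\mathrm{Sym}_i(V)$, $\beta\in\mathrm{Sym}_j(V)$, $\alpha\cdot\beta\in\mathrm{Sym}_{i+j}(V)$ is the concatenation; $A\cdot B=\{\alpha\cdot\beta:\alpha\in A,\beta\in B\}$ and $\alpha\cdot B=\{\alpha\}\cdot B$. For a matroid $M$ on $V$: $r_M$ is the rank function, $\operatorname{rank}M=r_M(V)$, $M^*$ is the dual, $L_M$ is the set of loops, $M|_X$ is the restriction to $X$. Strong order with relabelling: for matroids $M_1=(V_1,r_1)$, $M_2=(V_2,r_2)$ and a bijection $f:V_2\to V_1$, $M_1\preceq_{\rm s}M_2$ via $f$ means $r_1(f(Y))-r_1(f(X))\le r_2(Y)-r_2(X)$ for all $X\subseteq Y\subseteq V_2$. Let $N$ be a matroid on $\mathrm{Sym}_k(V)$, $k\ge 1$. Properties of $N$ with respect to $M$: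 - Symmetric Q-power: for all $1\le i\le k-1$ and all $\alpha_1,\alpha_2\in\mathrm{Sym}_i(V\setminus L_M)$, $N|_{\alpha_1\cdot\mathrm{Sym}_{k-i}(V)}$ is isomorphic to $N|_{\alpha_2\cdot\mathrm{Sym}_{k-i}(V)}$ via $\alpha_1\cdot\beta\mapsto\alpha_2\cdot\beta$; for all $\alpha\in\mathrm{Sym}_{k-1}(V\setminus L_M)$, $N|_{\alpha\cdot V}$ is isomorphic to $M$ via $\alpha\cdot v\mapsto v$; and $\alpha\cdot v$ is a loop of $N$ for all $\alpha\in\mathrm{Sym}_{k-1}(V)$, $v\in L_M$. - SP-rank Property: $\operatorname{rank}N=\binom{\operatorname{rank}M+k-1}{k}$. - $N$ is a $k$-th symmetric power of $M$ if it satisfies Symmetric Q-power and the SP-rank Property. - Flat Property: for every flat $F$ of $M$, $F\cdot\mathrm{Sym}_{k-1}(V)$ is a flat of $N$. - Multilinearity: for all $\tau\in\mathrm{Sym}_{k-1}(V\setminus L_M)$, $N|_{\tau\cdot V}$ is isomorphic to $M$ via $\tau\cdot v\mapsto v$; and $\tau\cdot v$ is a loop of $N$ for all $\tau\in\mathrm{Sym}_{k-1}(V)$, $v\in L_M$. - Circuit Multilinearity: for all $\tau\in\mathrm{Sym}_{k-1}(V\setminus L_M)$ and every circuit $X$ of $M$, $\tau\cdot X$ is a circuit of $N$; and $\tau\cdot v$ is a loop of $N$ for all $\tau\in\mathrm{Sym}_{k-1}(V)$, $v\in L_M$. - Strong Order Multilinearity: for all $\tau\in\mathrm{Sym}_{k-1}(V\setminus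 L_M)$, $M^*\preceq_{\rm s}(N|_{\tau\cdot V})^*$ via the bijection $\tau\cdot v\mapsto v$; and $\tau\cdot v$ is a loop of $N$ for all $\tau\in\mathrm{Sym}_{k-1}(V)$, $v\in L_M$. *)

theory Defs
  imports Main "HOL-Library.Multiset" "HOL-Library.Set_Algebras"
begin

section \<open>Matroids\<close>

text \<open>
  A matroid is a finite ground set with a rank function. The values of \<open>rk\<close> on sets that are not
  contained in the ground set are irrelevant: nothing below depends on them.
\<close>

record 'a ranked =
  ground :: "'a set"
  rk :: "'a set \<Rightarrow> nat"

locale matroid =
  fixes M :: "'a ranked"
  assumes finite_ground: "finite (ground M)"
    and rk_le_card: "X \<subseteq> ground M \<Longrightarrow> rk M X \<le> card X"
    and rk_mono: "X \<subseteq> Y \<Longrightarrow> Y \<subseteq> ground M \<Longrightarrow> rk M X \<le> rk M Y"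
    and rk_submod: "X \<subseteq> ground M \<Longrightarrow> Y \<subseteq> ground M \<Longrightarrow>
      rk M (X \<union> Y) + rk M (X \<inter> Y) \<le> rk M X + rk M Y"

definition rank :: "'a ranked \<Rightarrow> nat" where
  "rank M = rk M (ground M)"

definition indep :: "'a ranked \<Rightarrow> 'a set \<Rightarrow> bool" where
  "indep M X \<longleftrightarrow> X \<subseteq> ground M \<and> rk M X = card X"

definition circuit :: "'a ranked \<Rightarrow> 'a set \<Rightarrow> bool" where
  "circuit M X \<longleftrightarrow> X \<subseteq> ground M \<and> \<not> indep M X \<and> (\<forall>Y. Y \<subset> X \<longrightarrow> indep M Y)"

definition loops :: "'a ranked \<Rightarrow> 'a set" where
  "loops M = {v \<in> ground M. rk M {v} = 0}"

definition flat :: "'a ranked \<Rightarrow> 'a set \<Rightarrow> bool" where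
  "flat M F \<longleftrightarrow> F \<subseteq> ground M \<and> (\<forall>v \<in> ground M - F. rk M F < rk M (insert v F))"

definition restr :: "'a ranked \<Rightarrow> 'a set \<Rightarrow> 'a ranked" where
  "restr M X = \<lparr>ground = X, rk = rk M\<rparr>"

text \<open>The subtraction does not truncate on subsets of the ground set, see \<open>rk_dual\<close> below.\<close>

definition dual :: "'a ranked \<Rightarrow> 'a ranked" where
  "dual M = \<lparr>ground = ground M,
     rk = (\<lambda>X. card X + rk M (ground M - X) - rk M (ground M))\<rparr>"

definition iso_via :: "('a \<Rightarrow> 'b) \<Rightarrow> 'a ranked \<Rightarrow> 'b ranked \<Rightarrow> bool" where
  "iso_via f M1 M2 \<longleftrightarrow> bij_betw f (ground M1) (ground M2) \<and>
     (\<forall>X. X \<subseteq> ground M1 \<longrightarrow> rk M2 (f ` X) = rk M1 X)"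

text \<open>The strong order \<open>M1 \<preceq> M2\<close>, where the relabelling \<open>f\<close> goes from \<open>M2\<close> to \<open>M1\<close>.\<close>

definition strong_le_via :: "('b \<Rightarrow> 'a) \<Rightarrow> 'a ranked \<Rightarrow> 'b ranked \<Rightarrow> bool" where
  "strong_le_via f M1 M2 \<longleftrightarrow> bij_betw f (ground M2) (ground M1) \<and>
     (\<forall>X Y. X \<subseteq> Y \<and> Y \<subseteq> ground M2 \<longrightarrow>
        int (rk M1 (f ` Y)) - int (rk M1 (f ` X)) \<le> int (rk M2 Y) - int (rk M2 X))"

context matroid
begin

lemma matroid_restr:
  assumes "X \<subseteq> ground M"
  shows "matroid (restr M X)"
  by (rule matroid.intro)
     (use assms finite_ground rk_le_card rk_mono rk_submod in
       \<open>auto simp: restr_def intro: finite_subset\<close>)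

lemma rk_dual:
  assumes "X \<subseteq> ground M"
  shows "int (rk (dual M) X) = int (card X) + int (rk M (ground M - X)) - int (rk M (ground M))"
proof -
  have "X \<union> (ground M - X) = ground M" using assms by auto
  then have "rk M (ground M) \<le> rk M X + rk M (ground M - X)"
    using rk_submod[of X "ground M - X"] assms by simp
  then show ?thesis using rk_le_card[OF assms] by (simp add: dual_def)
qed

lemma matroid_dual: "matroid (dual M)"
proof (rule matroid.intro)
  show "finite (ground (dual M))" by (simp add: dual_def finite_ground)
next
  fix X assume "X \<subseteq> ground (dual M)"
  then show "rk (dual M) X \<le> card X"
    using rk_mono[of "ground M - X" "ground M"] by (simp add: dual_def)
next
  fix X Y assume XY: "X \<subseteq> Y" and "Y \<subseteq> ground (dual M)"
  then have Y: "Y \<subseteq> ground M" by (simp add: dual_def)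
  have fin: "finite Y" using Y finite_ground by (rule finite_subset)
  have "(Y - X) \<union> (ground M - Y) = ground M - X" using XY Y by auto
  moreover have "Y - X \<subseteq> ground M" "ground M - Y \<subseteq> ground M" using Y by auto
  ultimately have "rk M (ground M - X) \<le> rk M (Y - X) + rk M (ground M - Y)"
    using rk_submod[of "Y - X" "ground M - Y"] by simp
  moreover have "rk M (Y - X) \<le> card (Y - X)" using Y by (intro rk_le_card) auto
  moreover have "card Y = card X + card (Y - X)"
    using XY fin by (metis card_Diff_subset card_mono finite_subset le_add_diff_inverse)
  ultimately show "rk (dual M) X \<le> rk (dual M) Y" by (simp add: dual_def)
next
  fix X Y assume "X \<subseteq> ground (dual M)" "Y \<subseteq> ground (dual M)"
  then have X: "X \<subseteq> ground M" and Y: "Y \<subseteq> ground M" by (simp_all add: dual_def)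
  have "rk M (ground M - (X \<union> Y)) + rk M (ground M - (X \<inter> Y))
      \<le> rk M (ground M - X) + rk M (ground M - Y)"
    using rk_submod[of "ground M - X" "ground M - Y"]
    by (simp add: Diff_Un Diff_Int add.commute)
  moreover have "card (X \<union> Y) + card (X \<inter> Y) = card X + card Y"
    using X Y finite_ground by (metis card_Un_Int finite_subset)
  moreover have "X \<union> Y \<subseteq> ground M" "X \<inter> Y \<subseteq> ground M" using X Y by auto
  ultimately show "rk (dual M) (X \<union> Y) + rk (dual M) (X \<inter> Y) \<le> rk (dual M) X + rk (dual M) Y"
    using rk_dual[OF X] rk_dual[OF Y] rk_dual[of "X \<union> Y"] rk_dual[of "X \<inter> Y"] by linarith
qed

end

section \<open>Symmetric powers\<close>

text \<open>
  Unordered words are multisets, and concatenation is multiset addition. Hence \<open>A \<cdot> B\<close> is \<open>A + B\<close>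
  and \<open>\<alpha> \<cdot> B\<close> is \<open>\<alpha> +o B\<close> from \<^theory>\<open>HOL-Library.Set_Algebras\<close>. A set \<open>X\<close> of letters is turned into
  the set \<open>Sym 1 X\<close> of one-letter words wherever it occurs as a set of words.
\<close>

abbreviation Sym :: "nat \<Rightarrow> 'a set \<Rightarrow> 'a multiset set" where
  "Sym k V \<equiv> multisets_of_size V k"

lemma Sym_0: "Sym 0 V = {{#}}"
  by (auto simp: multisets_of_size_def)

lemma Sym_1: "Sym 1 V = (\<lambda>v. {#v#}) ` V"
proof
  show "Sym 1 V \<subseteq> (\<lambda>v. {#v#}) ` V"
  proof
    fix w assume w: "w \<in> Sym 1 V"
    then obtain v where "w = {#v#}"
      unfolding multisets_of_size_def using size_1_singleton_mset by blast
    with w show "w \<in> (\<lambda>v. {#v#}) ` V" by (simp add: multisets_of_size_def)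
  qed
qed (auto simp: multisets_of_size_def)

text \<open>The bijections \<open>\<tau> \<cdot> v \<mapsto> v\<close> and \<open>\<alpha> \<cdot> \<beta> \<mapsto> \<alpha>' \<cdot> \<beta>\<close>, as functions on words.\<close>

definition last_letter :: "'a multiset \<Rightarrow> 'a multiset \<Rightarrow> 'a" where
  "last_letter \<tau> = the_inv (\<lambda>v. \<tau> + {#v#})"

definition swap_prefix :: "'a multiset \<Rightarrow> 'a multiset \<Rightarrow> 'a multiset \<Rightarrow> 'a multiset" where
  "swap_prefix \<alpha> \<alpha>' w = \<alpha>' + (w - \<alpha>)"

lemma last_letter: "last_letter \<tau> (\<tau> + {#v#}) = v"
  unfolding last_letter_def by (rule the_inv_f_f) (simp add: inj_def)

lemma bij_betw_last_letter: "bij_betw (last_letter \<tau>) (\<tau> +o Sym 1 V) V"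
proof -
  have "\<tau> +o Sym 1 V = (\<lambda>v. \<tau> + {#v#}) ` V"
    unfolding Sym_1 elt_set_plus_def by blast
  moreover have "last_letter \<tau> ` (\<lambda>v. \<tau> + {#v#}) ` V = V"
    unfolding image_image last_letter by simp
  moreover have "inj_on (last_letter \<tau>) ((\<lambda>v. \<tau> + {#v#}) ` V)"
    by (rule inj_on_imageI) (simp only: comp_def last_letter inj_on_def, simp)
  ultimately show ?thesis by (simp add: bij_betw_def)
qed

lemma swap_prefix: "swap_prefix \<alpha> \<alpha>' (\<alpha> + \<beta>) = \<alpha>' + \<beta>"
  by (simp add: swap_prefix_def)

lemma bij_betw_swap_prefix: "bij_betw (swap_prefix \<alpha> \<alpha>') (\<alpha> +o B) (\<alpha>' +o B)"
  by (rule bij_betw_byWitness[where f' = "swap_prefix \<alpha>' \<alpha>"])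
     (auto simp: swap_prefix elt_set_plus_def)

text \<open>
  In all properties below, \<open>N\<close> is meant to be a matroid on \<open>Sym k (ground M)\<close> with \<open>k \<ge> 1\<close>.
\<close>

definition loops_multiply ::
    "nat \<Rightarrow> 'a ranked \<Rightarrow> 'a multiset ranked \<Rightarrow> bool" where
  "loops_multiply k M N \<longleftrightarrow>
     (\<forall>\<tau> \<in> Sym (k - 1) (ground M). \<forall>v \<in> loops M. \<tau> + {#v#} \<in> loops N)"

definition symmetric_Q_power :: "nat \<Rightarrow> 'a ranked \<Rightarrow> 'a multiset ranked \<Rightarrow> bool" where
  "symmetric_Q_power k M N \<longleftrightarrow>
     (\<forall>i \<in> {1..k - 1}. \<forall>\<alpha>1 \<in> Sym i (ground M - loops M). \<forall>\<alpha>2 \<in> Sym i (ground M - loops M).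
        iso_via (swap_prefix \<alpha>1 \<alpha>2)
          (restr N (\<alpha>1 +o Sym (k - i) (ground M))) (restr N (\<alpha>2 +o Sym (k - i) (ground M)))) \<and>
     (\<forall>\<alpha> \<in> Sym (k - 1) (ground M - loops M).
        iso_via (last_letter \<alpha>) (restr N (\<alpha> +o Sym 1 (ground M))) M) \<and>
     loops_multiply k M N"

definition SP_rank :: "nat \<Rightarrow> 'a ranked \<Rightarrow> 'a multiset ranked \<Rightarrow> bool" where
  "SP_rank k M N \<longleftrightarrow> rank N = (rank M + k - 1) choose k"

definition symmetric_power :: "nat \<Rightarrow> 'a ranked \<Rightarrow> 'a multiset ranked \<Rightarrow> bool" where
  "symmetric_power k M N \<longleftrightarrow> symmetric_Q_power k M N \<and> SP_rank k M N"

definition flat_property :: "nat \<Rightarrow> 'a ranked \<Rightarrow> 'a multiset ranked \<Rightarrow> bool" where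
  "flat_property k M N \<longleftrightarrow>
     (\<forall>F. flat M F \<longrightarrow> flat N (Sym 1 F + Sym (k - 1) (ground M)))"

definition multilinearity :: "nat \<Rightarrow> 'a ranked \<Rightarrow> 'a multiset ranked \<Rightarrow> bool" where
  "multilinearity k M N \<longleftrightarrow>
     (\<forall>\<tau> \<in> Sym (k - 1) (ground M - loops M).
        iso_via (last_letter \<tau>) (restr N (\<tau> +o Sym 1 (ground M))) M) \<and>
     loops_multiply k M N"

definition circuit_multilinearity :: "nat \<Rightarrow> 'a ranked \<Rightarrow> 'a multiset ranked \<Rightarrow> bool" where
  "circuit_multilinearity k M N \<longleftrightarrow>
     (\<forall>\<tau> \<in> Sym (k - 1) (ground M - loops M).
        \<forall>X. circuit M X \<longrightarrow> circuit N (\<tau> +o Sym 1 X)) \<and>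
     loops_multiply k M N"

definition strong_order_multilinearity ::
    "nat \<Rightarrow> 'a ranked \<Rightarrow> 'a multiset ranked \<Rightarrow> bool" where
  "strong_order_multilinearity k M N \<longleftrightarrow>
     (\<forall>\<tau> \<in> Sym (k - 1) (ground M - loops M).
        strong_le_via (last_letter \<tau>) (dual M) (dual (restr N (\<tau> +o Sym 1 (ground M))))) \<and>
     loops_multiply k M N"

end

theory Submission
  imports Defs
begin

text \<open>
  Strong Order Multilinearity says that \<open>v \<mapsto> t \<cdot> v\<close> maps the closure of \<open>A\<close> in \<open>M\<close> into the closure of
  \<open>t \<cdot> A\<close> in \<open>N\<close>, for every letter \<open>t\<close>. Hence \<open>Sym 2 B\<close> spans \<open>N\<close> for every basis \<open>B\<close> of \<open>M\<close>, and as
  it has the cardinality required by the SP-rank Property, that property holds exactly if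
  \<open>Sym 2 B\<close> is a basis of \<open>N\<close>. In this case a basis \<open>B\<close> through a nonloop \<open>t\<close> shows that \<open>t \<cdot> V\<close> has full
  rank, and a quotient of \<open>M\<close> with the rank of \<open>M\<close> is \<open>M\<close>: this is Multilinearity. If a word \<open>xy\<close> with
  \<open>x, y \<notin> F\<close> were in the closure of \<open>F \<cdot> V\<close> for a flat \<open>F\<close>, then \<open>xy\<close> or, by exchange, \<open>xx\<close> would depend on
  the other words over a basis extending one of \<open>F\<close> and containing \<open>x\<close>: this gives the Flat Property.
  Conversely, the flats spanned by \<open>B - {b}\<close> show that the squares \<open>bb\<close> are coloops of \<open>N\<close> restricted to
  \<open>Sym 2 B\<close>; after deleting the squares, the flats spanned by \<open>B - {b, c}\<close> handle the words \<open>bc\<close>.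
\<close>

section \<open>Closure, independence and circuits in terms of the rank function\<close>

definition closure :: "'a ranked \<Rightarrow> 'a set \<Rightarrow> 'a set" where
  "closure M A = {x \<in> ground M. rk M (insert x A) = rk M A}"

lemma closure_subset_ground: "closure M A \<subseteq> ground M"
  by (auto simp: closure_def)

context matroid
begin

lemma finite_subset_ground: "A \<subseteq> ground M \<Longrightarrow> finite A"
  using finite_ground by (rule rev_finite_subset)

lemma rk_empty: "rk M {} = 0"
  using rk_le_card[of "{}"] by simp

lemma rk_singleton_le: "x \<in> ground M \<Longrightarrow> rk M {x} \<le> 1"
  using rk_le_card[of "{x}"] by simp

lemma rk_insert_le:
  assumes "A \<subseteq> ground M" "x \<in> ground M"
  shows "rk M (insert x A) \<le> rk M A + 1"
  using rk_submod[of A "{x}"] rk_singleton_le[of x] assms by simp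

lemma rk_insert_ge:
  assumes "A \<subseteq> ground M" "x \<in> ground M"
  shows "rk M A \<le> rk M (insert x A)"
  using assms by (intro rk_mono) auto

lemma rk_insert:
  assumes "A \<subseteq> ground M" "x \<in> ground M" "x \<notin> closure M A"
  shows "rk M (insert x A) = rk M A + 1"
  using rk_insert_le[of A x] rk_insert_ge[of A x] assms by (auto simp: closure_def)

lemma closure_extensive: "A \<subseteq> ground M \<Longrightarrow> A \<subseteq> closure M A"
  by (auto simp: closure_def insert_absorb)

text \<open>Submodularity for \<open>insert x A\<close> and \<open>B\<close>, which meet in
  \<open>A\<close> if \<open>x\<close> is not in \<open>B\<close>: adding \<open>x\<close> raises
  the rank of \<open>B\<close> by at most as much as that of \<open>A\<close>.\<close>

lemma closure_mono:
  assumes "A \<subseteq> B" "B \<subseteq> ground M"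
  shows "closure M A \<subseteq> closure M B"
proof
  fix x assume x: "x \<in> closure M A"
  show "x \<in> closure M B"
  proof (cases "x \<in> B")
    case True
    then show ?thesis using closure_extensive assms by auto
  next
    case False
    have "insert x A \<union> B = insert x B" "insert x A \<inter> B = A"
      using False assms by auto
    moreover have "insert x A \<subseteq> ground M" using x assms by (auto simp: closure_def)
    ultimately have "rk M (insert x B) \<le> rk M B"
      using rk_submod[of "insert x A" B] assms x by (simp add: closure_def)
    then show ?thesis
      using rk_insert_ge[of B x] x assms by (auto simp: closure_def)
  qed
qed

lemma rk_Un_closure:
  assumes A: "A \<subseteq> ground M" and B: "B \<subseteq> closure M A"
  shows "rk M (A \<union> B) = rk M A"
proof -
  have "finite B" using B closure_subset_ground[of M A] by (intro finite_subset_ground) auto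
  then show ?thesis using B
  proof (induction B)
    case (insert x B)
    have "closure M A \<subseteq> closure M (A \<union> B)"
      using insert.prems A closure_subset_ground[of M A] by (intro closure_mono) auto
    then have "x \<in> closure M (A \<union> B)" using insert.prems by auto
    then show ?case using insert by (simp add: closure_def)
  qed simp
qed

lemma closure_closure:
  assumes A: "A \<subseteq> ground M" and B: "B \<subseteq> closure M A"
  shows "closure M B \<subseteq> closure M A"
proof
  fix x assume x: "x \<in> closure M B"
  have BG: "B \<subseteq> ground M" using B closure_subset_ground[of M A] by auto
  have "x \<in> closure M (A \<union> B)" using closure_mono[of B "A \<union> B"] A BG x by auto
  then have "rk M (insert x (A \<union> B)) = rk M A"
    using rk_Un_closure[OF A B] by (simp add: closure_def)
  moreover have xg: "x \<in> ground M" using x by (simp add: closure_def)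
  moreover have "rk M (insert x A) \<le> rk M (insert x (A \<union> B))"
    using A BG xg by (intro rk_mono) auto
  ultimately show "x \<in> closure M A"
    using rk_insert_ge[OF A xg] by (simp add: closure_def)
qed

lemma rk_closure_eq:
  assumes "A \<subseteq> B" "B \<subseteq> closure M A"
  shows "rk M B = rk M A"
  using rk_Un_closure[of A B] assms closure_subset_ground[of M A]
  by (auto simp: sup.absorb2)

text \<open>Adding \<open>x\<close> to \<open>insert y A\<close> gives a set of the same rank as
  \<open>insert x A\<close>, hence of rank at most \<open>rk M A + 1\<close>, and
  \<open>insert y A\<close> has this rank already.\<close>

lemma closure_exchange:
  assumes A: "A \<subseteq> ground M" and x: "x \<in> ground M"
    and y: "y \<in> closure M (insert x A)" "y \<notin> closure M A"
  shows "x \<in> closure M (insert y A)"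
proof -
  have yg: "y \<in> ground M" using y by (simp add: closure_def)
  have "rk M (insert x (insert y A)) = rk M (insert x A)"
    using y by (simp add: closure_def insert_commute)
  moreover have "rk M (insert y A) = rk M A + 1" using A yg y(2) by (rule rk_insert)
  moreover have "rk M (insert y A) \<le> rk M (insert x (insert y A))"
    using A x yg by (intro rk_mono) auto
  ultimately show ?thesis using rk_insert_le[OF A x] x by (simp add: closure_def)
qed

lemma flat_iff_closure_subset: "flat M F \<longleftrightarrow> F \<subseteq> ground M \<and> closure M F \<subseteq> F"
proof -
  have "rk M F < rk M (insert v F) \<longleftrightarrow> v \<notin> closure M F" if "F \<subseteq> ground M" "v \<in> ground M" for v
    using rk_insert_ge[OF that] that by (auto simp: closure_def)
  then show ?thesis using closure_subset_ground[of M F] unfolding flat_def by blast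
qed

lemma flat_closure: "A \<subseteq> ground M \<Longrightarrow> flat M (closure M A)"
  using closure_closure[of A "closure M A"] closure_subset_ground[of M A]
  by (simp add: flat_iff_closure_subset)

lemma loop_in_closure:
  assumes "v \<in> loops M" "A \<subseteq> ground M"
  shows "v \<in> closure M A"
proof -
  have "v \<in> closure M {}" using assms rk_empty by (simp add: loops_def closure_def)
  then show ?thesis using closure_mono[of "{}" A] assms by auto
qed

lemma indep_empty: "indep M {}"
  by (simp add: indep_def rk_empty)

lemma indep_insert:
  assumes "indep M A" "x \<in> ground M" "x \<notin> closure M A"
  shows "indep M (insert x A)"
proof -
  have A: "A \<subseteq> ground M" using assms by (simp add: indep_def)
  then have "x \<notin> A" using assms(3) closure_extensive by auto
  then show ?thesis
    using assms rk_insert[of A x] finite_subset_ground[OF A] by (simp add: indep_def)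
qed

text \<open>An independent set loses rank with every deleted element. Conversely, \<open>X\<close>
  is built up one element at a time, each outside the closure of the earlier ones.\<close>

lemma indep_iff_closure:
  assumes X: "X \<subseteq> ground M"
  shows "indep M X \<longleftrightarrow> (\<forall>x\<in>X. x \<notin> closure M (X - {x}))"
proof
  assume I: "indep M X"
  show "\<forall>x\<in>X. x \<notin> closure M (X - {x})"
  proof
    fix x assume x: "x \<in> X"
    have "rk M (X - {x}) \<le> card (X - {x})" using X by (intro rk_le_card) auto
    also have "\<dots> < rk M X"
      using I card_Diff1_less[OF finite_subset_ground[OF X] x] by (simp add: indep_def)
    finally show "x \<notin> closure M (X - {x})" using x by (simp add: closure_def insert_absorb)
  qed
next
  assume *: "\<forall>x\<in>X. x \<notin> closure M (X - {x})"
  have "indep M Y" if "finite Y" "Y \<subseteq> X" for Y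
    using that
  proof (induction Y)
    case empty
    show ?case by (rule indep_empty)
  next
    case (insert y Y)
    have "closure M Y \<subseteq> closure M (X - {y})"
      using insert X by (intro closure_mono) auto
    then show ?case using insert X * by (intro indep_insert) auto
  qed
  then show "indep M X" using finite_subset_ground[OF X] by simp
qed

lemma indep_subset:
  assumes "indep M Y" "X \<subseteq> Y"
  shows "indep M X"
proof -
  have Y: "Y \<subseteq> ground M" using assms by (simp add: indep_def)
  have "closure M (X - {x}) \<subseteq> closure M (Y - {x})" for x
    using assms Y by (intro closure_mono) auto
  then show ?thesis
    using assms Y indep_iff_closure[of X] indep_iff_closure[of Y] by blast
qed

text \<open>A maximal independent set between \<open>I\<close> and \<open>A\<close> works, since an
  element of \<open>A\<close> outside its closure could be added. With \<open>A = ground M\<close>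
  this yields bases of \<open>M\<close> through prescribed independent elements.\<close>

lemma indep_extend:
  assumes "indep M I" "I \<subseteq> A" "A \<subseteq> ground M"
  obtains B where "I \<subseteq> B" "B \<subseteq> A" "indep M B" "A \<subseteq> closure M B"
proof -
  let ?S = "{B. B \<subseteq> A \<and> indep M B}"
  have "finite ?S" using finite_subset_ground[OF assms(3)] by simp
  then obtain B where B: "B \<in> ?S" "I \<subseteq> B" and max: "\<And>B'. B' \<in> ?S \<Longrightarrow> B \<subseteq> B' \<Longrightarrow> B = B'"
    using finite_has_maximal2[of ?S I] assms by auto
  have BG: "B \<subseteq> ground M" using B assms by auto
  have "x \<in> closure M B" if x: "x \<in> A" for x
  proof (rule ccontr)
    assume *: "x \<notin> closure M B"
    then have "indep M (insert x B)" using B x assms by (intro indep_insert) auto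
    then have "B = insert x B" using B x by (intro max) auto
    then show False using * closure_extensive[OF BG] by auto
  qed
  then show ?thesis using B that[of B] by auto
qed

lemma indep_singleton:
  assumes "v \<in> ground M - loops M"
  shows "indep M {v}"
  using assms rk_singleton_le[of v] by (auto simp: indep_def loops_def)

lemma spanning_rank:
  assumes "B \<subseteq> ground M" "ground M \<subseteq> closure M B"
  shows "rk M B = rank M"
  using rk_closure_eq[of B "ground M"] assms by (simp add: rank_def)

lemma circuit_closure:
  assumes "circuit M C" "x \<in> C"
  shows "x \<in> closure M (C - {x})"
proof -
  have C: "C \<subseteq> ground M" "indep M (C - {x})" "\<not> indep M C"
    using assms by (auto simp: circuit_def)
  then have "\<not> x \<notin> closure M (C - {x})"
    using indep_insert[of "C - {x}" x] assms by (auto simp: insert_absorb)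
  then show ?thesis by simp
qed

text \<open>Take \<open>B\<close> minimal in \<open>A\<close> with \<open>x\<close> in its closure.
  If some \<open>b\<close> in \<open>B\<close> depended on \<open>B - {b}\<close>, then
  \<open>x\<close> would too, against minimality; so \<open>B\<close> is independent and
  \<open>insert x B\<close> is the circuit.\<close>

lemma circuit_exists:
  assumes A: "A \<subseteq> ground M" and x: "x \<in> closure M A" "x \<notin> A"
  obtains C where "circuit M C" "x \<in> C" "C \<subseteq> insert x A"
proof -
  let ?S = "{B. B \<subseteq> A \<and> x \<in> closure M B}"
  have "finite ?S" using finite_subset_ground[OF A] by simp
  then obtain B where B: "B \<subseteq> A" "x \<in> closure M B" and min: "\<And>B'. B' \<in> ?S \<Longrightarrow> B' \<subseteq> B \<Longrightarrow> B = B'"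
    using finite_has_minimal2[of ?S A] x by auto
  have BG: "B \<subseteq> ground M" and xB: "x \<notin> B" using B A x by auto
  have xg: "x \<in> ground M" using x by (simp add: closure_def)
  have minus: "x \<notin> closure M (B - {b})" if "b \<in> B" for b
    using min[of "B - {b}"] B that by auto
  have indB: "indep M B"
    unfolding indep_iff_closure[OF BG]
  proof
    fix b assume b: "b \<in> B"
    show "b \<notin> closure M (B - {b})"
    proof
      assume "b \<in> closure M (B - {b})"
      then have "B \<subseteq> closure M (B - {b})"
        using closure_extensive[of "B - {b}"] BG by auto
      then have "closure M B \<subseteq> closure M (B - {b})" using BG by (intro closure_closure) auto
      then show False using minus[OF b] B by auto
    qed
  qed
  have "circuit M (insert x B)"
    unfolding circuit_def
  proof (intro conjI allI impI)
    show "insert x B \<subseteq> ground M" using BG xg by auto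
    then show "\<not> indep M (insert x B)"
      using B xB by (auto simp: indep_iff_closure)
    fix Y assume "Y \<subset> insert x B"
    then obtain c where c: "c \<in> insert x B" "Y \<subseteq> insert x B - {c}" by blast
    have "indep M (insert x B - {c})"
    proof (cases "c = x")
      case True
      then show ?thesis using indB xB by simp
    next
      case False
      then have "insert x B - {c} = insert x (B - {c})" by auto
      moreover have "indep M (B - {c})" using indB by (rule indep_subset) auto
      ultimately show ?thesis using minus[of c] c False xg indep_insert[of "B - {c}" x] by auto
    qed
    then show "indep M Y" using c(2) by (rule indep_subset)
  qed
  then show ?thesis using that B by blast
qed

end

section \<open>The strong order as a comparison of rank increments\<close>

lemma strong_le_via_dual_iff:
  assumes M1: "matroid M1" and M2: "matroid M2" and bij: "bij_betw f (ground M2) (ground M1)"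
  shows "strong_le_via f (dual M1) (dual M2) \<longleftrightarrow>
    (\<forall>X Y. X \<subseteq> Y \<and> Y \<subseteq> ground M2 \<longrightarrow>
       int (rk M2 Y) - int (rk M2 X) \<le> int (rk M1 (f ` Y)) - int (rk M1 (f ` X)))"
    (is "?L \<longleftrightarrow> ?R")
proof -
  let ?G = "ground M2"
  define P where "P X Y \<longleftrightarrow>
    int (rk M2 Y) - int (rk M2 X) \<le> int (rk M1 (f ` Y)) - int (rk M1 (f ` X))" for X Y
  define D where "D X Y \<longleftrightarrow> int (rk (dual M1) (f ` Y)) - int (rk (dual M1) (f ` X))
    \<le> int (rk (dual M2) Y) - int (rk (dual M2) X)" for X Y
  have compl: "f ` (?G - X) = ground M1 - f ` X" if "X \<subseteq> ?G" for X
    using inj_on_image_set_diff[of f ?G ?G X] bij that by (auto simp: bij_betw_def)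
  have card: "card (f ` X) = card X" if "X \<subseteq> ?G" for X
    using bij_betw_subset[OF bij that] by (simp add: bij_betw_def card_image)
  have img: "f ` X \<subseteq> ground M1" if "X \<subseteq> ?G" for X
    using image_mono[OF that, of f] bij by (simp add: bij_betw_def)
  \<comment> \<open>By \<open>rk_dual\<close> the cardinalities and the full ranks cancel, because
    \<open>f\<close> preserves cardinalities and complements. What remains is the inequality for the
    complements, whose inclusion is reversed.\<close>
  have *: "D X Y \<longleftrightarrow> P (?G - Y) (?G - X)" if "X \<subseteq> ?G" "Y \<subseteq> ?G" for X Y
    using that matroid.rk_dual[OF M1 img] matroid.rk_dual[OF M2]
    by (simp add: D_def P_def compl card) linarith
  have "(\<forall>X Y. X \<subseteq> Y \<and> Y \<subseteq> ?G \<longrightarrow> D X Y) \<longleftrightarrow> (\<forall>X Y. X \<subseteq> Y \<and> Y \<subseteq> ?G \<longrightarrow> P X Y)"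
  proof (intro iffI allI impI)
    fix X Y assume H: "\<forall>X Y. X \<subseteq> Y \<and> Y \<subseteq> ?G \<longrightarrow> D X Y" and XY: "X \<subseteq> Y \<and> Y \<subseteq> ?G"
    have "D (?G - Y) (?G - X)" using H[rule_format, of "?G - Y" "?G - X"] XY by auto
    moreover have "?G - (?G - X) = X" "?G - (?G - Y) = Y" using XY by auto
    ultimately show "P X Y" using *[of "?G - Y" "?G - X"] by simp
  next
    fix X Y assume H: "\<forall>X Y. X \<subseteq> Y \<and> Y \<subseteq> ?G \<longrightarrow> P X Y" and XY: "X \<subseteq> Y \<and> Y \<subseteq> ?G"
    have "P (?G - Y) (?G - X)" using H[rule_format, of "?G - Y" "?G - X"] XY by auto
    then show "D X Y" using *[of X Y] XY by auto
  qed
  then show ?thesis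
    using bij by (simp add: strong_le_via_def D_def P_def dual_def)
qed

text \<open>Pass from \<open>X\<close> to \<open>Y\<close> one element at a time. An element that
  leaves the rank in \<open>M\<close> unchanged does so in \<open>N\<close> by the closure
  hypothesis; any other raises the rank by exactly 1 in \<open>M\<close> and by at most 1 in
  \<open>N\<close>.\<close>

lemma rk_increment_le:
  assumes M: "matroid M" and N: "matroid N"
    and g: "g ` ground M \<subseteq> ground N"
    and cl: "\<And>A x. A \<subseteq> ground M \<Longrightarrow> x \<in> closure M A \<Longrightarrow> g x \<in> closure N (g ` A)"
    and XY: "X \<subseteq> Y" "Y \<subseteq> ground M"
  shows "rk N (g ` Y) + rk M X \<le> rk N (g ` X) + rk M Y"
proof -
  interpret M: matroid M by fact
  interpret N: matroid N by fact
  have "rk N (g ` (X \<union> Z)) + rk M X \<le> rk N (g ` X) + rk M (X \<union> Z)"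
    if "finite Z" "Z \<subseteq> Y" for Z
    using that
  proof (induction Z)
    case (insert z Z)
    have XZ: "X \<union> Z \<subseteq> ground M" "z \<in> ground M" using insert.prems XY by auto
    show ?case
    proof (cases "z \<in> closure M (X \<union> Z)")
      case True
      then have "g z \<in> closure N (g ` (X \<union> Z))" using XZ by (intro cl)
      then have "rk N (insert (g z) (g ` (X \<union> Z))) = rk N (g ` (X \<union> Z))"
        by (simp add: closure_def)
      moreover have "rk M (insert z (X \<union> Z)) = rk M (X \<union> Z)" using True by (simp add: closure_def)
      ultimately show ?thesis using insert by simp
    next
      case False
      then have "rk M (insert z (X \<union> Z)) = rk M (X \<union> Z) + 1" using XZ by (intro M.rk_insert)
      moreover have "rk N (insert (g z) (g ` (X \<union> Z))) \<le> rk N (g ` (X \<union> Z)) + 1"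
        using XZ g by (intro N.rk_insert_le) auto
      ultimately show ?thesis using insert by simp
    qed
  qed simp
  from this[of Y] show ?thesis
    using XY M.finite_subset_ground by (simp add: sup.absorb2)
qed

section \<open>Two-letter words\<close>

definition words :: "'a set \<Rightarrow> 'a set \<Rightarrow> 'a multiset set" where
  "words A B = {{#a, b#} | a b. a \<in> A \<and> b \<in> B}"

lemma pair_mset_eq_iff: "{#a, b#} = {#c, d#} \<longleftrightarrow> a = c \<and> b = d \<or> a = d \<and> b = c"
  by (auto simp: add_eq_conv_ex)

lemma words_iff: "{#x, y#} \<in> words A B \<longleftrightarrow> x \<in> A \<and> y \<in> B \<or> y \<in> A \<and> x \<in> B"
  by (auto simp: words_def pair_mset_eq_iff)

lemma words_mono: "A \<subseteq> A' \<Longrightarrow> B \<subseteq> B' \<Longrightarrow> words A B \<subseteq> words A' B'"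
  unfolding words_def by blast

lemma Sym_1_plus_Sym_1: "Sym 1 A + Sym 1 B = words A B"
  unfolding Sym_1 set_plus_def words_def by (auto simp: add_mset_commute)

lemma Sym_2_eq_words: "Sym 2 A = words A A"
proof
  show "Sym 2 A \<subseteq> words A A"
  proof
    fix w assume w: "w \<in> Sym 2 A"
    then have "size w = Suc 1" by (simp add: multisets_of_size_def)
    then obtain a u where "w = add_mset a u" "size u = 1"
      using size_eq_Suc_imp_eq_union[of w 1] by auto
    then obtain b where ab: "w = {#a, b#}" using size_1_singleton_mset by blast
    then show "w \<in> words A A" using w by (auto simp: words_iff multisets_of_size_def)
  qed
qed (auto simp: words_def multisets_of_size_def)

lemma singleton_plus_Sym_1: "{#t#} +o Sym 1 A = (\<lambda>v. {#t, v#}) ` A"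
  unfolding Sym_1 elt_set_plus_def by auto

lemma last_letter_singleton: "last_letter {#t#} {#t, v#} = v"
  using last_letter[of "{#t#}" v] by (simp add: add_mset_commute)

lemma ball_Sym_1: "(\<forall>\<tau>\<in>Sym (2 - 1) A. P \<tau>) \<longleftrightarrow> (\<forall>t\<in>A. P {#t#})"
  using Sym_1[of A] by simp

lemma inj_prefix: "inj_on (\<lambda>v. {#t, v#}) A"
  by (simp add: inj_on_def)

section \<open>The properties of \<open>N\<close> for \<open>k = 2\<close>, stated with ranks of
  sets \<open>t \<cdot> A\<close>\<close>

locale matroid_on_Sym_2 = M: matroid M + N: matroid N
  for M :: "'a ranked" and N :: "'a multiset ranked" +
  assumes ground_N: "ground N = Sym 2 (ground M)"
begin

abbreviation V where "V \<equiv> ground M"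
abbreviation L where "L \<equiv> loops M"

abbreviation prefix :: "'a \<Rightarrow> 'a set \<Rightarrow> 'a multiset set" where
  "prefix t A \<equiv> (\<lambda>v. {#t, v#}) ` A"

lemma words_subset_ground: "A \<subseteq> V \<Longrightarrow> B \<subseteq> V \<Longrightarrow> words A B \<subseteq> ground N"
  unfolding ground_N Sym_2_eq_words by (rule words_mono)

lemma prefix_subset_ground: "t \<in> V \<Longrightarrow> A \<subseteq> V \<Longrightarrow> prefix t A \<subseteq> ground N"
  unfolding ground_N Sym_2_eq_words by (auto simp: words_iff)

lemma loops_multiply_iff:
  "loops_multiply 2 M N \<longleftrightarrow> (\<forall>t\<in>V. \<forall>v\<in>L. {#t, v#} \<in> loops N)"
  unfolding loops_multiply_def ball_Sym_1 by (simp add: add_mset_commute)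

lemma multilinearity_iff:
  "multilinearity 2 M N \<longleftrightarrow> loops_multiply 2 M N \<and>
     (\<forall>t\<in>V - L. \<forall>A. A \<subseteq> V \<longrightarrow> rk N (prefix t A) = rk M A)"
proof -
  have "iso_via (last_letter {#t#}) (restr N (prefix t V)) M \<longleftrightarrow>
      (\<forall>A. A \<subseteq> V \<longrightarrow> rk N (prefix t A) = rk M A)" for t
  proof -
    have "bij_betw (last_letter {#t#}) (prefix t V) V"
      using bij_betw_last_letter[of "{#t#}" V] by (simp only: singleton_plus_Sym_1)
    then show ?thesis
      by (auto simp: iso_via_def restr_def all_subset_image image_image last_letter_singleton)
  qed
  then show ?thesis
    unfolding multilinearity_def ball_Sym_1 singleton_plus_Sym_1 by auto
qed

text \<open>By \<open>strong_le_via_dual_iff\<close> the duals disappear: rank increments along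
  \<open>t \<cdot> V\<close> are at most those of \<open>M\<close>. The sums avoid truncated
  subtraction.\<close>

lemma strong_order_multilinearity_iff:
  "strong_order_multilinearity 2 M N \<longleftrightarrow> loops_multiply 2 M N \<and>
     (\<forall>t\<in>V - L. \<forall>X Y. X \<subseteq> Y \<and> Y \<subseteq> V \<longrightarrow>
        rk N (prefix t Y) + rk M X \<le> rk N (prefix t X) + rk M Y)"
proof -
  have "strong_le_via (last_letter {#t#}) (dual M) (dual (restr N (prefix t V))) \<longleftrightarrow>
      (\<forall>X Y. X \<subseteq> Y \<and> Y \<subseteq> V \<longrightarrow>
        rk N (prefix t Y) + rk M X \<le> rk N (prefix t X) + rk M Y)" (is "?L \<longleftrightarrow> ?R")
    if t: "t \<in> V" for t
  proof -
    have bij: "bij_betw (last_letter {#t#}) (ground (restr N (prefix t V))) V"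
      using bij_betw_last_letter[of "{#t#}" V] by (simp add: restr_def singleton_plus_Sym_1[unfolded One_nat_def])
    have "?L \<longleftrightarrow> (\<forall>X Y. X \<subseteq> Y \<and> Y \<subseteq> prefix t V \<longrightarrow>
        int (rk N Y) - int (rk N X)
          \<le> int (rk M (last_letter {#t#} ` Y)) - int (rk M (last_letter {#t#} ` X)))"
      using strong_le_via_dual_iff[OF M.matroid_axioms N.matroid_restr bij] t
      by (simp add: prefix_subset_ground restr_def)
    also have "\<dots> \<longleftrightarrow> ?R"
    proof (intro iffI allI impI; elim conjE)
      fix X Y assume *: "\<forall>X Y. X \<subseteq> Y \<and> Y \<subseteq> prefix t V \<longrightarrow>
        int (rk N Y) - int (rk N X)
          \<le> int (rk M (last_letter {#t#} ` Y)) - int (rk M (last_letter {#t#} ` X))"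
        and XY: "X \<subseteq> Y" "Y \<subseteq> V"
      show "rk N (prefix t Y) + rk M X \<le> rk N (prefix t X) + rk M Y"
        using *[rule_format, of "prefix t X" "prefix t Y"] XY
        by (simp add: image_mono image_image last_letter_singleton)
    next
      fix X Y assume *: ?R and XY: "X \<subseteq> Y" "Y \<subseteq> prefix t V"
      obtain Y' where Y': "Y' \<subseteq> V" "Y = prefix t Y'" using XY by (auto simp: subset_image_iff)
      then obtain X' where X': "X' \<subseteq> Y'" "X = prefix t X'" using XY by (auto simp: subset_image_iff)
      show "int (rk N Y) - int (rk N X)
          \<le> int (rk M (last_letter {#t#} ` Y)) - int (rk M (last_letter {#t#} ` X))"
        using *[rule_format, of X' Y'] X' Y' by (simp add: image_image last_letter_singleton)
    qed
    finally show ?thesis .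
  qed
  then show ?thesis
    unfolding strong_order_multilinearity_def ball_Sym_1 singleton_plus_Sym_1 by auto
qed

lemma circuit_multilinearity_iff:
  "circuit_multilinearity 2 M N \<longleftrightarrow> loops_multiply 2 M N \<and>
     (\<forall>t\<in>V - L. \<forall>X. circuit M X \<longrightarrow> circuit N (prefix t X))"
  unfolding circuit_multilinearity_def ball_Sym_1 singleton_plus_Sym_1 by auto

lemma flat_property_iff:
  "flat_property 2 M N \<longleftrightarrow> (\<forall>F. flat M F \<longrightarrow> flat N (words F V))"
proof -
  have "(2::nat) - 1 = 1" by simp
  then show ?thesis unfolding flat_property_def by (simp only: Sym_1_plus_Sym_1)
qed

text \<open>For \<open>k = 2\<close> the only prefix length is \<open>i = 1\<close>, and
  restrictions \<open>s \<cdot> V\<close> and \<open>t \<cdot> V\<close> that are both isomorphic to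
  \<open>M\<close> are isomorphic to each other.\<close>

lemma symmetric_Q_power_iff_multilinearity:
  "symmetric_Q_power 2 M N \<longleftrightarrow> multilinearity 2 M N"
proof
  assume "multilinearity 2 M N"
  have "iso_via (swap_prefix {#s#} {#t#}) (restr N (prefix s V)) (restr N (prefix t V))"
    if "s \<in> V - L" "t \<in> V - L" for s t
    unfolding iso_via_def
  proof (intro conjI allI impI)
    show "bij_betw (swap_prefix {#s#} {#t#}) (ground (restr N (prefix s V)))
        (ground (restr N (prefix t V)))"
      using bij_betw_swap_prefix[of "{#s#}" "{#t#}" "Sym 1 V"]
      by (simp add: restr_def singleton_plus_Sym_1[unfolded One_nat_def])
    fix X assume "X \<subseteq> ground (restr N (prefix s V))"
    then obtain A where A: "A \<subseteq> V" "X = prefix s A"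
      by (auto simp: restr_def subset_image_iff)
    have "swap_prefix {#s#} {#t#} {#s, v#} = {#t, v#}" for v
      using swap_prefix[of "{#s#}" "{#t#}" "{#v#}"] by (simp add: add_mset_commute)
    then have "swap_prefix {#s#} {#t#} ` X = prefix t A"
      using A by (simp add: image_image)
    then show "rk (restr N (prefix t V)) (swap_prefix {#s#} {#t#} ` X) =
        rk (restr N (prefix s V)) X"
      using \<open>multilinearity 2 M N\<close> A that by (simp add: restr_def multilinearity_iff)
  qed
  then have "\<forall>s\<in>V - L. \<forall>t\<in>V - L. iso_via (swap_prefix {#s#} {#t#})
      (restr N ({#s#} +o Sym 1 V)) (restr N ({#t#} +o Sym 1 V))"
    by (simp only: singleton_plus_Sym_1) blast
  then have "\<forall>i\<in>{1..2 - 1}. \<forall>\<alpha>1\<in>Sym i (V - L). \<forall>\<alpha>2\<in>Sym i (V - L).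
      iso_via (swap_prefix \<alpha>1 \<alpha>2) (restr N (\<alpha>1 +o Sym (2 - i) V)) (restr N (\<alpha>2 +o Sym (2 - i) V))"
    by (simp add: Sym_1[unfolded One_nat_def])
  with \<open>multilinearity 2 M N\<close> show "symmetric_Q_power 2 M N"
    unfolding symmetric_Q_power_def multilinearity_def by blast
qed (auto simp: symmetric_Q_power_def multilinearity_def)

section \<open>From Multilinearity through circuits to the strong order\<close>

lemma multilinearity_imp_circuit_multilinearity:
  assumes "multilinearity 2 M N"
  shows "circuit_multilinearity 2 M N"
proof -
  have "circuit N (prefix t X)" if t: "t \<in> V - L" and X: "circuit M X" for t X
  proof -
    have ind: "indep N (prefix t A) \<longleftrightarrow> indep M A" if "A \<subseteq> V" for A
      using assms t that prefix_subset_ground[of t A]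
      by (simp add: multilinearity_iff indep_def card_image inj_prefix)
    have XV: "X \<subseteq> V" using X by (simp add: circuit_def)
    have "indep N Y" if "Y \<subset> prefix t X" for Y
    proof -
      have "Y \<subseteq> prefix t X" using that by auto
      then obtain A where A: "A \<subseteq> X" "Y = prefix t A" by (rule subset_imageE)
      then have "A \<subset> X" using that by auto
      then show ?thesis using A X XV ind[of A] by (auto simp: circuit_def)
    qed
    then show ?thesis
      using X XV t ind[of X] prefix_subset_ground[of t X] by (auto simp: circuit_def)
  qed
  then show ?thesis using assms by (simp add: circuit_multilinearity_iff multilinearity_iff)
qed

text \<open>A circuit witnessing that \<open>x\<close> depends on \<open>A\<close> is carried to one
  witnessing that \<open>t \<cdot> x\<close> depends on \<open>t \<cdot> A\<close>. So closures are
  respected and \<open>rk_increment_le\<close> applies.\<close>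

lemma circuit_multilinearity_imp_strong_order:
  assumes "circuit_multilinearity 2 M N"
  shows "strong_order_multilinearity 2 M N"
proof -
  have "rk N (prefix t Y) + rk M X \<le> rk N (prefix t X) + rk M Y"
    if t: "t \<in> V - L" and XY: "X \<subseteq> Y" "Y \<subseteq> V" for t X Y
  proof (rule rk_increment_le[OF M.matroid_axioms N.matroid_axioms _ _ XY])
    show "prefix t V \<subseteq> ground N" using t by (intro prefix_subset_ground) auto
    fix A x assume A: "A \<subseteq> V" and x: "x \<in> closure M A"
    have tA: "prefix t A \<subseteq> ground N" using t A by (intro prefix_subset_ground) auto
    show "{#t, x#} \<in> closure N (prefix t A)"
    proof (cases "x \<in> A")
      case True
      then show ?thesis using N.closure_extensive[OF tA] by auto
    next
      case False
      then obtain C where C: "circuit M C" "x \<in> C" "C \<subseteq> insert x A"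
        using M.circuit_exists[OF A x] by blast
      then have "circuit N (prefix t C)" using assms t by (simp add: circuit_multilinearity_iff)
      then have "{#t, x#} \<in> closure N (prefix t C - {{#t, x#}})"
        using C by (intro N.circuit_closure) auto
      moreover have "closure N (prefix t C - {{#t, x#}}) \<subseteq> closure N (prefix t A)"
        using C tA by (intro N.closure_mono) auto
      ultimately show ?thesis by auto
    qed
  qed
  then show ?thesis
    using assms by (simp add: circuit_multilinearity_iff strong_order_multilinearity_iff)
qed

section \<open>Words over a basis of \<open>M\<close> and the rank of \<open>N\<close>\<close>

lemma prefix_closure:
  assumes so: "strong_order_multilinearity 2 M N"
    and t: "t \<in> V" and A: "A \<subseteq> V" and x: "x \<in> closure M A"
  shows "{#t, x#} \<in> closure N (prefix t A)"
proof (cases "t \<in> L")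
  \<comment> \<open>If the prefix \<open>t\<close> is itself a loop, then \<open>t \<cdot> x\<close>
    is a loop of \<open>N\<close>, as words are unordered. So the claim extends to all letters
    \<open>t\<close>.\<close>
  case True
  have "x \<in> V" using x by (simp add: closure_def)
  then have "{#x, t#} \<in> loops N"
    using so True by (simp add: strong_order_multilinearity_iff loops_multiply_iff)
  then show ?thesis
    using t A by (intro N.loop_in_closure prefix_subset_ground) (simp add: add_mset_commute)
next
  case False
  have xV: "x \<in> V" using x by (simp add: closure_def)
  have g: "prefix t A \<subseteq> ground N" "{#t, x#} \<in> ground N"
    using prefix_subset_ground[of t A] prefix_subset_ground[of t "{x}"] t A xV by auto
  have "\<forall>X Y. X \<subseteq> Y \<and> Y \<subseteq> V \<longrightarrow>
      rk N (prefix t Y) + rk M X \<le> rk N (prefix t X) + rk M Y"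
    using so t False by (simp add: strong_order_multilinearity_iff)
  from this[rule_format, of A "insert x A"]
  have "rk N (insert {#t, x#} (prefix t A)) + rk M A \<le> rk N (prefix t A) + rk M (insert x A)"
    using A xV by auto
  then show ?thesis using N.rk_insert_ge[OF g] g x by (simp add: closure_def)
qed

text \<open>The letters are replaced one after the other: first \<open>a\<close> is spanned by
  \<open>A\<close> behind each fixed \<open>v\<close> in \<open>B\<close>, then \<open>b\<close> is
  spanned by \<open>B\<close> behind the fixed \<open>a\<close>.\<close>

lemma words_closure:
  assumes so: "strong_order_multilinearity 2 M N"
    and A: "A \<subseteq> V" and B: "B \<subseteq> V"
  shows "words (closure M A) (closure M B) \<subseteq> closure N (words A B)"
proof
  fix w assume "w \<in> words (closure M A) (closure M B)"
  then obtain a b where w: "w = {#a, b#}" and a: "a \<in> closure M A" and b: "b \<in> closure M B"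
    unfolding words_def by blast
  have aV: "a \<in> V" using a by (simp add: closure_def)
  have "{#a, v#} \<in> closure N (words A B)" if v: "v \<in> B" for v
  proof -
    have "{#v, a#} \<in> closure N (prefix v A)" using so a v A B by (intro prefix_closure) auto
    moreover have "closure N (prefix v A) \<subseteq> closure N (words A B)"
      using v A B by (intro N.closure_mono words_subset_ground) (auto simp: words_iff)
    ultimately show ?thesis by (auto simp: add_mset_commute)
  qed
  then have "closure N (prefix a B) \<subseteq> closure N (words A B)"
    using A B by (intro N.closure_closure words_subset_ground) auto
  then show "w \<in> closure N (words A B)"
    using prefix_closure[OF so aV B b] w by auto
qed

lemma Sym_2_subset_ground: "B \<subseteq> V \<Longrightarrow> Sym 2 B \<subseteq> ground N"
  unfolding ground_N by (rule multisets_of_size_mono)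

lemma SP_rank_iff_indep:
  assumes so: "strong_order_multilinearity 2 M N"
    and B: "indep M B" "V \<subseteq> closure M B"
  shows "SP_rank 2 M N \<longleftrightarrow> indep N (Sym 2 B)"
proof -
  have BV: "B \<subseteq> V" and cardB: "rk M B = card B" using B by (auto simp: indep_def)
  have "ground N \<subseteq> closure N (Sym 2 B)"
    using words_closure[OF so BV BV] words_mono[OF B(2) B(2)]
    unfolding ground_N Sym_2_eq_words by blast
  then have "rk N (Sym 2 B) = rank N" using BV by (intro N.spanning_rank Sym_2_subset_ground)
  \<comment> \<open>The SP-rank value is the number of unordered pairs, with repetition, from the
    \<open>rank M\<close> elements of \<open>B\<close>; so the property says that the spanning set
    \<open>Sym 2 B\<close> has rank equal to its size.\<close>
  moreover have "card (Sym 2 B) = (rank M + 2 - 1) choose 2"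
    using card_multisets_of_size[OF M.finite_subset_ground[OF BV], of 2]
      M.spanning_rank[OF BV B(2)] cardB by simp
  ultimately show ?thesis using Sym_2_subset_ground[OF BV] by (simp add: SP_rank_def indep_def)
qed

lemma strong_order_imp_multilinearity:
  assumes so: "strong_order_multilinearity 2 M N" and sp: "SP_rank 2 M N"
  shows "multilinearity 2 M N"
proof -
  have "rk N (prefix t A) = rk M A" if t: "t \<in> V - L" and A: "A \<subseteq> V" for t A
  proof -
    obtain B where B: "{t} \<subseteq> B" "B \<subseteq> V" "indep M B" "V \<subseteq> closure M B"
      using M.indep_extend[OF M.indep_singleton[OF t], of V] t by auto
    have "prefix t B \<subseteq> Sym 2 B" using B by (auto simp: Sym_2_eq_words words_iff)
    then have "indep N (prefix t B)"
      using SP_rank_iff_indep[OF so B(3,4)] sp N.indep_subset by blast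
    then have "rk N (prefix t B) = card B" by (simp add: indep_def card_image inj_prefix)
    moreover have "rk N (prefix t B) \<le> rk N (prefix t V)"
      using t B by (intro N.rk_mono prefix_subset_ground) auto
    moreover have "rk M V = card B"
      using M.spanning_rank[OF B(2,4)] B(3) by (simp add: rank_def indep_def)
    moreover have incr: "\<forall>X Y. X \<subseteq> Y \<and> Y \<subseteq> V \<longrightarrow>
        rk N (prefix t Y) + rk M X \<le> rk N (prefix t X) + rk M Y"
      using so t by (simp add: strong_order_multilinearity_iff)
    \<comment> \<open>The increment from \<open>A\<close> to \<open>V\<close> bounds
      \<open>rk N (prefix t A)\<close> from below, because \<open>t \<cdot> V\<close> has full rank;
      the increment from the empty set to \<open>A\<close> bounds it from above.\<close>
    ultimately show ?thesis
      using incr[rule_format, of A V] incr[rule_format, of "{}" A] A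
      by (simp add: M.rk_empty N.rk_empty)
  qed
  then show ?thesis
    using so by (simp add: multilinearity_iff strong_order_multilinearity_iff)
qed

section \<open>The SP-rank Property yields the Flat Property\<close>

lemma strong_order_imp_flat_property:
  assumes so: "strong_order_multilinearity 2 M N" and sp: "SP_rank 2 M N"
  shows "flat_property 2 M N"
  unfolding flat_property_iff
proof (intro allI impI)
  fix F assume "flat M F"
  then have FV: "F \<subseteq> V" and F: "closure M F \<subseteq> F" by (auto simp: M.flat_iff_closure_subset)
  obtain I where I: "I \<subseteq> F" "indep M I" "F \<subseteq> closure M I"
    using M.indep_extend[OF M.indep_empty, of F] FV by auto
  have IV: "I \<subseteq> V" using I FV by auto
  have clI: "closure M I \<subseteq> F" using M.closure_mono[OF I(1) FV] F by auto
  have ind: "\<not> w \<in> closure N (words I B)"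
    if B: "I \<subseteq> B" "B \<subseteq> V" "indep M B" "V \<subseteq> closure M B" and w: "w \<in> Sym 2 B" "w \<notin> words I V"
    for B w
  proof -
    have "indep N (Sym 2 B)" using SP_rank_iff_indep[OF so B(3,4)] sp by simp
    then have "w \<notin> closure N (Sym 2 B - {w})"
      using N.indep_iff_closure[OF Sym_2_subset_ground[OF B(2)]] w by blast
    moreover have "words I B \<subseteq> Sym 2 B - {w}"
      using B w words_mono[of I B B B] words_mono[of I I B V] by (auto simp: Sym_2_eq_words)
    then have "closure N (words I B) \<subseteq> closure N (Sym 2 B - {w})"
      using Sym_2_subset_ground[OF B(2)] by (intro N.closure_mono) auto
    ultimately show ?thesis by auto
  qed
  \<comment> \<open>The basis \<open>B\<close> stays arbitrary here, so that it can be chosen to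
    suit the letters of the word that is tested.\<close>
  have clFV: "closure N (words F V) \<subseteq> closure N (words I B)"
    if B: "B \<subseteq> V" "V \<subseteq> closure M B" for B
  proof (rule N.closure_closure)
    show "words I B \<subseteq> ground N" using IV B(1) by (rule words_subset_ground)
    show "words F V \<subseteq> closure N (words I B)"
      using words_closure[OF so IV B(1)] words_mono[OF I(3) B(2)] by blast
  qed
  have "w \<in> words F V" if w: "w \<in> closure N (words F V)" for w
  proof -
    have "w \<in> words V V"
      using w closure_subset_ground[of N "words F V"] by (auto simp: ground_N Sym_2_eq_words)
    then obtain x y where xy: "w = {#x, y#}" "x \<in> V" "y \<in> V" unfolding words_def by blast
    have False if x: "x \<notin> F" and y: "y \<notin> F"
    proof -
      have indx: "indep M (insert x I)" using I xy x clI by (intro M.indep_insert) auto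
      show False
      proof (cases "y \<in> closure M (insert x I)")
        \<comment> \<open>One basis contains \<open>I\<close>, \<open>x\<close> and
          \<open>y\<close>, and the word \<open>xy\<close> over it has no letter in
          \<open>I\<close>.\<close>
        case False
        then have "indep M (insert y (insert x I))" using indx xy False by (simp add: M.indep_insert)
        then obtain B where B: "insert y (insert x I) \<subseteq> B" "B \<subseteq> V" "indep M B" "V \<subseteq> closure M B"
          using M.indep_extend[of "insert y (insert x I)" V] xy IV by auto
        have "w \<notin> closure N (words I B)"
          using B x y xy I by (intro ind) (auto simp: words_iff Sym_2_eq_words)
        then show False using w clFV[OF B(2,4)] by auto
      next
        case True
        obtain B where B: "insert x I \<subseteq> B" "B \<subseteq> V" "indep M B" "V \<subseteq> closure M B"
          using M.indep_extend[OF indx, of V] xy IV by auto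
        \<comment> \<open>No basis need contain both letters, and \<open>y = x\<close> may occur.
          Exchange makes \<open>xx\<close> depend on \<open>xy\<close> and the words
          \<open>x \<cdot> I\<close>, all in the closure of \<open>words I B\<close>; now
          \<open>xx\<close> is a word over \<open>B\<close> that avoids \<open>I\<close>.\<close>
        have "x \<in> closure M (insert y I)"
          by (rule M.closure_exchange[OF IV _ True]) (use xy y clI in auto)
        then have "{#x, x#} \<in> closure N (prefix x (insert y I))"
          using so xy IV by (intro prefix_closure) auto
        moreover have "prefix x (insert y I) \<subseteq> closure N (words I B)"
        proof -
          have "w \<in> closure N (words I B)" using w clFV[OF B(2,4)] by auto
          moreover have "prefix x I \<subseteq> words I B" using B by (auto simp: words_iff)
          ultimately show ?thesis
            using xy N.closure_extensive[OF words_subset_ground[OF IV B(2)]] by auto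
        qed
        then have "closure N (prefix x (insert y I)) \<subseteq> closure N (words I B)"
          using IV B by (intro N.closure_closure words_subset_ground) auto
        moreover have "{#x, x#} \<notin> closure N (words I B)"
          using B x I by (intro ind) (auto simp: words_iff Sym_2_eq_words)
        ultimately show False by auto
      qed
    qed
    then show ?thesis using xy by (auto simp: words_iff)
  qed
  then show "flat N (words F V)"
    using words_subset_ground[OF FV] by (auto simp: N.flat_iff_closure_subset)
qed

section \<open>The Flat Property yields the SP-rank Property\<close>

lemma flat_property_imp_SP_rank:
  assumes so: "strong_order_multilinearity 2 M N" and fp: "flat_property 2 M N"
  shows "SP_rank 2 M N"
proof -
  obtain B where BV: "B \<subseteq> V" and B: "indep M B" "V \<subseteq> closure M B"
    using M.indep_extend[OF M.indep_empty, of V] by auto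
  let ?S = "Sym 2 B"
  note SV = Sym_2_subset_ground[OF BV]
  \<comment> \<open>Words with a letter in \<open>A\<close> all lie in the flat
    \<open>words (closure M A) V\<close>, so their closure stays inside it.\<close>
  have notin: "w \<notin> closure N T"
    if T: "T \<subseteq> words A V" and A: "A \<subseteq> V" and w: "w \<notin> words (closure M A) V" for w T A
  proof -
    let ?F = "words (closure M A) V"
    have "flat N ?F" using fp A M.flat_closure by (auto simp: flat_property_iff)
    then have F: "?F \<subseteq> ground N" "closure N ?F \<subseteq> ?F" by (auto simp: N.flat_iff_closure_subset)
    have "T \<subseteq> ?F" using T words_mono[OF M.closure_extensive[OF A], of V V] by blast
    then show ?thesis using N.closure_mono[of T ?F] F w by auto
  qed
  have cl: "b \<notin> closure M (B - {b})" if "b \<in> B" for b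
    using that B M.indep_iff_closure[OF BV] by blast
  \<comment> \<open>Every word over \<open>B\<close> other than \<open>bb\<close> has a letter in
    \<open>B - {b}\<close>.\<close>
  have square: "{#b, b#} \<notin> closure N (?S - {{#b, b#}})" if b: "b \<in> B" for b
  proof (rule notin)
    show "?S - {{#b, b#}} \<subseteq> words (B - {b}) V"
    proof
      fix w assume w: "w \<in> ?S - {{#b, b#}}"
      then obtain x y where "w = {#x, y#}" "x \<in> B" "y \<in> B"
        unfolding Sym_2_eq_words words_def by blast
      then show "w \<in> words (B - {b}) V" using w BV by (auto simp: words_iff)
    qed
    show "{#b, b#} \<notin> words (closure M (B - {b})) V" using cl[OF b] by (simp add: words_iff)
  qed (use BV in auto)
  have mixed: "{#b, c#} \<notin> closure N (?S - {{#b, c#}})" if b: "b \<in> B" and c: "c \<in> B" and "b \<noteq> c" for b c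
  proof
    \<comment> \<open>No single flat separates \<open>bc\<close> from all other words, since
      \<open>bb\<close> and \<open>cc\<close> have no letter in \<open>B - {b, c}\<close>. Hence the
      squares are taken out first.\<close>
    let ?T = "?S - {{#b, b#}, {#c, c#}, {#b, c#}}"
    have S: "{#b, b#} \<in> ?S" "{#c, c#} \<in> ?S" "{#b, c#} \<in> ?S"
      using b c by (auto simp: Sym_2_eq_words words_iff)
    have ne: "{#b, b#} \<noteq> {#c, c#}" "{#b, b#} \<noteq> {#b, c#}" "{#c, c#} \<noteq> {#b, c#}"
      using \<open>b \<noteq> c\<close> by (auto simp: pair_mset_eq_iff)
    assume "{#b, c#} \<in> closure N (?S - {{#b, c#}})"
    moreover have "?S - {{#b, c#}} = insert {#b, b#} (insert {#c, c#} ?T)" using S ne by auto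
    ultimately have 1: "{#b, c#} \<in> closure N (insert {#b, b#} (insert {#c, c#} ?T))" by simp
    \<comment> \<open>If \<open>bb\<close> were essential for the dependence of \<open>bc\<close>,
      exchange would make \<open>bb\<close> depend on the other words, against
      \<open>square\<close>.\<close>
    have 3: "{#b, c#} \<in> closure N (insert {#c, c#} ?T)"
    proof (rule ccontr)
      assume 2: "{#b, c#} \<notin> closure N (insert {#c, c#} ?T)"
      have "{#b, b#} \<in> closure N (insert {#b, c#} (insert {#c, c#} ?T))"
        by (rule N.closure_exchange[OF _ _ 1 2]) (use S SV in auto)
      moreover have "insert {#b, c#} (insert {#c, c#} ?T) = ?S - {{#b, b#}}" using S ne by auto
      ultimately show False using square[OF b] by simp
    qed
    have 4: "{#b, c#} \<notin> closure N ?T"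
    proof (rule notin)
      show "?T \<subseteq> words (B - {b, c}) V"
      proof
        fix w assume w: "w \<in> ?T"
        then obtain x y where "w = {#x, y#}" "x \<in> B" "y \<in> B"
          unfolding Sym_2_eq_words words_def by blast
        then show "w \<in> words (B - {b, c}) V" using w BV by (auto simp: words_iff add_mset_commute)
      qed
      have "closure M (B - {b, c}) \<subseteq> closure M (B - {b})" "closure M (B - {b, c}) \<subseteq> closure M (B - {c})"
        using BV by (intro M.closure_mono; blast)+
      then show "{#b, c#} \<notin> words (closure M (B - {b, c})) V"
        using cl[OF b] cl[OF c] by (auto simp: words_iff)
    qed (use BV in auto)
    \<comment> \<open>The same exchange for \<open>cc\<close>: by \<open>4\<close> the words in
      \<open>?T\<close> alone do not span \<open>bc\<close>, so \<open>cc\<close> would depend on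
      \<open>bc\<close> and \<open>?T\<close>.\<close>
    have "{#c, c#} \<in> closure N (insert {#b, c#} ?T)"
      by (rule N.closure_exchange[OF _ _ 3 4]) (use S SV in auto)
    moreover have "closure N (insert {#b, c#} ?T) \<subseteq> closure N (?S - {{#c, c#}})"
      using S SV ne by (intro N.closure_mono) auto
    ultimately show False using square[OF c] by auto
  qed
  have "w \<notin> closure N (?S - {w})" if "w \<in> ?S" for w
    using that square mixed by (auto simp: Sym_2_eq_words words_def)
  then have "indep N ?S" using N.indep_iff_closure[OF SV] by blast
  then show ?thesis using SP_rank_iff_indep[OF so B] by simp
qed

end

theorem theorem2p1:
  fixes M :: "'a ranked" and N :: "'a multiset ranked"
  assumes "matroid M" and "matroid N" and "ground N = Sym 2 (ground M)"
  shows "(symmetric_power 2 M N \<longleftrightarrow> SP_rank 2 M N \<and> multilinearity 2 M N) \<and>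
    (symmetric_power 2 M N \<longleftrightarrow> SP_rank 2 M N \<and> circuit_multilinearity 2 M N) \<and>
    (symmetric_power 2 M N \<longleftrightarrow> SP_rank 2 M N \<and> strong_order_multilinearity 2 M N) \<and>
    (symmetric_power 2 M N \<longleftrightarrow> flat_property 2 M N \<and> strong_order_multilinearity 2 M N)"
proof -
  interpret matroid_on_Sym_2 M N
    using assms by (simp add: matroid_on_Sym_2_def matroid_on_Sym_2_axioms_def)
  show ?thesis
    \<comment> \<open>Under the SP-rank Property the three multilinearity conditions form a cycle of
      implications; under Strong Order Multilinearity the SP-rank and Flat Properties imply each
      other.\<close>
    unfolding symmetric_power_def symmetric_Q_power_iff_multilinearity
    using multilinearity_imp_circuit_multilinearity circuit_multilinearity_imp_strong_order
      strong_order_imp_multilinearity strong_order_imp_flat_property flat_property_imp_SP_rank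
    by blast
qed

end
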